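(* Let $p\ge 2$ be an integer and let $r_0=r_0(p)$ be the smallest integer $r_0\ge 2$ such that $$\min_{r\ge 2}\{F_v(2_r,p;r+p-1)-r\} = F_v(2_{r_0},p;r_0+p-1)-r_0.$$ Then: (a) $F_v(2_r,p;r+p-1) = F_v(2_{r_0},p;r_0+p-1)+r-r_0$ for all $r\ge r_0$; (b) if $r_0=2$, then $F_v(2_r,p;r+p-1)=F_v(2,2,p;p+1)+r-2$ for all $r\ge 2$; (c) if $r_0>2$ and $G$ is a graph with $G \overset{v}{\rightarrow}(2_{r_0},p)$, $\omega(G)<r_0+p-1$ and $|V(G)| = F_v(2_{r_0},p;r_0+p-1)$, then $G \overset{v}{\rightarrow} (2, r_0+p-2)$; (d) $r_0 < F_v(2,2,p;p+1)-2p$; in particular $r_0(5)\le 5$.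
   Context: All graphs are finite, simple, undirected. For a graph $G$, $G \overset{v}{\rightarrow} (a_1,\dots,a_s)$ means: for every coloring of $V(G)$ with $s$ colors there is an $i$ such that $G$ contains an $a_i$-clique all of whose vertices have color $i$. $F_v(a_1,\dots,a_s;q)$ is the minimum number of vertices of a graph $G$ with $G \overset{v}{\rightarrow} (a_1,\dots,a_s)$ and clique number $\omega(G)<q$. $(2_t,p)$ denotes $t$ twos followed by $p$. *)

theory Defs
  imports "HOL-Library.Ramsey" "HOL-Library.FuncSet"
begin

text \<open>Graphs are given by a vertex set and a set of two-element subsets of it, in the style of
  \<^const>\<open>clique\<close> from the Ramsey theory.\<close>

definition simple_graph :: "'a set \<Rightarrow> 'a set set \<Rightarrow> bool" where
  "simple_graph V E \<longleftrightarrow> finite V \<and> E \<subseteq> nsets V 2"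

definition clique_number :: "'a set \<Rightarrow> 'a set set \<Rightarrow> nat" where
  "clique_number V E = Max {card K |K. K \<subseteq> V \<and> clique K E}"

text \<open>The colors are the positions \<open>0, \<dots>, s - 1\<close> of the list \<open>as = [a\<^sub>1, \<dots>, a\<^sub>s]\<close>.\<close>

definition vertex_arrows :: "'a set \<Rightarrow> 'a set set \<Rightarrow> nat list \<Rightarrow> bool" where
  "vertex_arrows V E as \<longleftrightarrow>
     (\<forall>c \<in> V \<rightarrow> {..<length as}. \<exists>i < length as. \<exists>K \<in> nsets V (as ! i).
        clique K E \<and> (\<forall>v \<in> K. c v = i))"

text \<open>Every finite graph is isomorphic to one whose vertices are natural numbers, so restricting
  the vertex type to \<^typ>\<open>nat\<close> does not change the minimum.\<close>

definition vertex_Folkman :: "nat list \<Rightarrow> nat \<Rightarrow> nat" where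
  "vertex_Folkman as q =
     (LEAST n. \<exists>(V :: nat set) E. simple_graph V E \<and> card V = n \<and>
        vertex_arrows V E as \<and> clique_number V E < q)"

text \<open>The difference is taken in \<^typ>\<open>int\<close> to avoid truncated subtraction.\<close>

definition Folkman_r0 :: "nat \<Rightarrow> nat" where
  "Folkman_r0 p =
     (LEAST r. is_arg_min
        (\<lambda>r. int (vertex_Folkman (replicate r 2 @ [p]) (r + p - 1)) - int r) (\<lambda>r. 2 \<le> r) r)"

end

theory Submission
  imports Defs
begin

text \<open>
  Write \<open>F r\<close> for the Folkman number of \<open>(2\<^sub>r, p)\<close>. Adding a universal vertex gives
  \<open>F (r + 1) \<le> F r + 1\<close>, whence (a) and (b). If the minimal graph in (c) had an independent set whose
  removal destroys all cliques of size \<open>r0 + p - 2\<close>, the rest would show that \<open>r0 - 1\<close> is also a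
  minimiser.

  For (d), suppose that all cliques of a graph on \<open>n\<close> vertices have size at most \<open>a\<close> and that a
  clique of size \<open>a\<close> survives the deletion of any vertex. By Hall's theorem a maximum clique can be
  matched along non-edges into its complement, so the graph is \<open>(n - a)\<close>-colourable; on the other
  hand a graph that arrows \<open>(2\<^sub>r, p)\<close> needs at least \<open>r + p\<close> colours. For \<open>r0 > 2\<close> this is applied
  to the minimal graph, using (c), and for \<open>r0 = 2\<close> after deletion of a non-adjacent pair.

  Graphs that arrow \<open>(2, 2, p)\<close> without cliques of size \<open>p + 1\<close> are joins of such graphs for
  \<open>p = 2\<close> and \<open>p = 3\<close>; the bound for \<open>p = 5\<close> comes from a graph on 16 vertices.
\<close>

subsection \<open>Cliques and arrowing\<close>

lemma clique_pair_iff: "clique {u, v} E \<longleftrightarrow> u = v \<or> {u, v} \<in> E"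
  by (auto simp: clique_def insert_commute)

text \<open>A 2-clique of one colour is a monochromatic edge, and \<open>p\<close> sits at the last
  list position \<open>r\<close>. So arrowing fails exactly if some \<open>r\<close> independent
  sets together meet every \<open>p\<close>-clique; most later arguments use this form.\<close>

lemma vertex_arrows_twos_iff:
  "vertex_arrows V E (replicate r 2 @ [p]) \<longleftrightarrow>
     (\<forall>c \<in> V \<rightarrow> {..r}. (\<exists>u\<in>V. \<exists>v\<in>V. u \<noteq> v \<and> {u, v} \<in> E \<and> c u = c v \<and> c u < r) \<or>
        (\<exists>K \<in> nsets V p. clique K E \<and> (\<forall>v\<in>K. c v = r)))"
proof -
  have edge: "(\<exists>K \<in> nsets V 2. clique K E \<and> (\<forall>v\<in>K. c v = i)) \<longleftrightarrow>
      (\<exists>u\<in>V. \<exists>v\<in>V. u \<noteq> v \<and> {u, v} \<in> E \<and> c u = i \<and> c v = i)" (is "?L \<longleftrightarrow> ?R") for c :: "'a \<Rightarrow> nat" and i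
  proof
    assume ?L
    then obtain K where K: "K \<subseteq> V" "card K = 2" "clique K E" "\<forall>v\<in>K. c v = i"
      by (auto simp: nsets_def)
    then obtain u v where "K = {u, v}" "u \<noteq> v" by (auto simp: card_2_iff)
    with K show ?R by (auto simp: clique_pair_iff)
  next
    assume ?R
    then obtain u v where "u \<in> V" "v \<in> V" "u \<noteq> v" "{u, v} \<in> E" "c u = i" "c v = i"
      by blast
    then show ?L
      by (intro bexI[of _ "{u, v}"]) (auto simp: clique_pair_iff nsets_def)
  qed
  have "(\<exists>i < length (replicate r 2 @ [p]). \<exists>K \<in> nsets V ((replicate r 2 @ [p]) ! i).
          clique K E \<and> (\<forall>v\<in>K. c v = i)) \<longleftrightarrow>
        (\<exists>u\<in>V. \<exists>v\<in>V. u \<noteq> v \<and> {u, v} \<in> E \<and> c u = c v \<and> c u < r) \<or>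
        (\<exists>K \<in> nsets V p. clique K E \<and> (\<forall>v\<in>K. c v = r))" (is "?L c \<longleftrightarrow> _")
    for c :: "'a \<Rightarrow> nat"
  proof -
    define Q where "Q i a \<longleftrightarrow> (\<exists>K \<in> nsets V a. clique K E \<and> (\<forall>v\<in>K. c v = i))" for i a
    have "?L c \<longleftrightarrow> (\<exists>i < Suc r. Q i ((replicate r 2 @ [p]) ! i))"
      by (simp add: Q_def)
    also have "\<dots> \<longleftrightarrow> (\<exists>i<r. Q i 2) \<or> Q r p"
      unfolding less_Suc_eq by (metis length_replicate nth_append nth_append_length nth_replicate)
    also have "(\<exists>i<r. Q i 2) \<longleftrightarrow>
        (\<exists>u\<in>V. \<exists>v\<in>V. u \<noteq> v \<and> {u, v} \<in> E \<and> c u = c v \<and> c u < r)"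
      unfolding Q_def edge by metis
    finally show ?thesis by (simp only: Q_def)
  qed
  moreover have "{..<length (replicate r 2 @ [p])} = {..r}" by auto
  ultimately show ?thesis
    unfolding vertex_arrows_def by simp
qed

lemma clique_number_less_iff:
  assumes "finite V"
  shows "clique_number V E < q \<longleftrightarrow> (\<forall>K \<subseteq> V. clique K E \<longrightarrow> card K < q)"
proof -
  have "finite {card K |K. K \<subseteq> V \<and> clique K E}"
    by (rule finite_subset[of _ "card ` Pow V"]) (use assms in auto)
  moreover have "{card K |K. K \<subseteq> V \<and> clique K E} \<noteq> {}"
    by (auto intro!: exI[of _ "{}"] simp: clique_def)
  ultimately show ?thesis
    unfolding clique_number_def by (auto simp: Max_less_iff)
qed

lemma clique_subset: "clique K E \<Longrightarrow> L \<subseteq> K \<Longrightarrow> clique L E"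
  by (auto simp: clique_def)

lemma clique_change_edges:
  assumes "clique K F" "L \<subseteq> K" "\<And>u v. u \<in> L \<Longrightarrow> v \<in> L \<Longrightarrow> {u, v} \<in> F \<Longrightarrow> {u, v} \<in> E"
  shows "clique L E"
  using assms unfolding clique_def by (meson subsetD)

lemma clique_insert:
  "clique (insert v K) E \<longleftrightarrow> clique K E \<and> (\<forall>u\<in>K. u \<noteq> v \<longrightarrow> {v, u} \<in> E)"
  by (auto simp: clique_def insert_commute)

subsection \<open>Cliques that survive vertex deletion\<close>

text \<open>Induction on \<open>card S\<close>. If a nonempty proper subset \<open>T\<close> has no
  more neighbours than elements, \<open>T\<close> and \<open>S - T\<close> are matched separately.
  Otherwise every such subset has a spare neighbour, so one pair can be matched first and its
  partner deleted.\<close>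

lemma Hall_marriage:
  fixes N :: "'a \<Rightarrow> 'b set"
  assumes "finite S" "\<And>x. x \<in> S \<Longrightarrow> finite (N x)"
    and "\<And>X. X \<subseteq> S \<Longrightarrow> card X \<le> card (\<Union>(N ` X))"
  shows "\<exists>f. inj_on f S \<and> (\<forall>x\<in>S. f x \<in> N x)"
  using assms
proof (induction "card S" arbitrary: S N rule: less_induct)
  case less
  note fin = less.prems(1,2) and Hall = less.prems(3)
  have finU: "finite (\<Union>(N ` X))" if "X \<subseteq> S" for X
    using that fin finite_subset[OF that] by auto
  show ?case
  proof (cases "S = {}")
    case True
    then show ?thesis by simp
  next
    case False
    then obtain x where x: "x \<in> S" by blast
    show ?thesis
    proof (cases "\<exists>T. T \<subset> S \<and> T \<noteq> {} \<and> card (\<Union>(N ` T)) \<le> card T")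
      case True
      then obtain T where T: "T \<subset> S" "T \<noteq> {}" "card (\<Union>(N ` T)) \<le> card T" by blast
      then have finT: "finite T" and finR: "finite (S - T)"
        using fin(1) finite_subset by auto
      have "\<exists>f. inj_on f T \<and> (\<forall>x\<in>T. f x \<in> N x)"
        by (rule less.hyps) (use T fin finT Hall psubset_card_mono in auto)
      then obtain f where f: "inj_on f T" "\<forall>x\<in>T. f x \<in> N x" by blast
      \<comment> \<open>Hall's condition survives on \<open>S - T\<close>: apply it to
        \<open>X \<union> T\<close> and subtract the neighbours of \<open>T\<close>, of which there
        are at most \<open>card T\<close>.\<close>
      define N' where "N' x = N x - \<Union>(N ` T)" for x
      have "\<exists>g. inj_on g (S - T) \<and> (\<forall>x\<in>S - T. g x \<in> N' x)"
      proof (rule less.hyps)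
        show "card (S - T) < card S"
          using T fin(1) by (intro psubset_card_mono) auto
        show "card X \<le> card (\<Union>(N' ` X))" if X: "X \<subseteq> S - T" for X
        proof -
          have XT: "X \<union> T \<subseteq> S" using X T(1) by auto
          have "card X + card T = card (X \<union> T)"
            using X finT finite_subset[OF X finR] by (subst card_Un_disjoint) auto
          also have "\<dots> \<le> card (\<Union>(N ` (X \<union> T)))" by (rule Hall[OF XT])
          also have "\<Union>(N ` (X \<union> T)) = \<Union>(N' ` X) \<union> \<Union>(N ` T)"
            by (auto simp: N'_def)
          also have "card \<dots> \<le> card (\<Union>(N' ` X)) + card (\<Union>(N ` T))"
            by (rule card_Un_le)
          finally show ?thesis using T(3) by simp
        qed
      qed (use finR fin in \<open>auto simp: N'_def\<close>)
      then obtain g where g: "inj_on g (S - T)" "\<forall>x\<in>S - T. g x \<in> N' x" by blast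
      define h where "h x = (if x \<in> T then f x else g x)" for x
      have "inj_on h S"
      proof (rule inj_onI)
        fix a b assume ab: "a \<in> S" "b \<in> S" "h a = h b"
        have "g v \<noteq> f u" if "u \<in> T" "v \<in> S - T" for u v
          using f(2) g(2) that unfolding N'_def by blast
        then show "a = b"
          using ab f(1) g(1) unfolding h_def
          by (metis DiffI inj_onD)
      qed
      moreover have "\<forall>x\<in>S. h x \<in> N x" using f g by (auto simp: h_def N'_def)
      ultimately show ?thesis by blast
    next
      case False
      then have strict: "card T < card (\<Union>(N ` T))" if "T \<subset> S" "T \<noteq> {}" for T
        using that by (meson not_le)
      have "card {x} \<le> card (\<Union>(N ` {x}))" using x by (intro Hall) auto
      then obtain y where y: "y \<in> N x" by fastforce
      define N' where "N' z = N z - {y}" for z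
      have "\<exists>g. inj_on g (S - {x}) \<and> (\<forall>z\<in>S - {x}. g z \<in> N' z)"
      proof (rule less.hyps)
        show "card (S - {x}) < card S" using x fin(1) by (rule card_Diff1_less[rotated])
        show "card X \<le> card (\<Union>(N' ` X))" if X: "X \<subseteq> S - {x}" for X
        proof (cases "X = {}")
          case False
          then have "card X < card (\<Union>(N ` X))" using X x by (intro strict) auto
          moreover have "\<Union>(N' ` X) = \<Union>(N ` X) - {y}" by (auto simp: N'_def)
          moreover have "finite (\<Union>(N ` X))" using X by (intro finU) auto
          ultimately show ?thesis by (simp only: card_Diff_singleton_if) auto
        qed simp
      qed (use fin in \<open>auto simp: N'_def\<close>)
      then obtain g where g: "inj_on g (S - {x})" "\<forall>z\<in>S - {x}. g z \<in> N' z" by blast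
      have "inj_on (g(x := y)) S"
        using g by (auto simp: inj_on_def N'_def)
      moreover have "\<forall>z\<in>S. (g(x := y)) z \<in> N z" using g y by (auto simp: N'_def)
      ultimately show ?thesis by blast
    qed
  qed
qed

section \<open>Colourings from maximum cliques\<close>

definition proper_coloring :: "'a set \<Rightarrow> 'a set set \<Rightarrow> nat \<Rightarrow> ('a \<Rightarrow> nat) \<Rightarrow> bool" where
  "proper_coloring V E k c \<longleftrightarrow>
     c \<in> V \<rightarrow> {..<k} \<and> (\<forall>u\<in>V. \<forall>v\<in>V. u \<noteq> v \<and> {u, v} \<in> E \<longrightarrow> c u \<noteq> c v)"

text \<open>An exchange argument gives Hall's condition for matching a maximum clique
  \<open>S\<close> along non-edges to vertices outside \<open>S\<close>: at a smallest violating
  \<open>X\<close>, a maximum clique \<open>T\<close> that avoids some \<open>x\<close> in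
  \<open>X\<close> could be enlarged. Matched vertices then share a colour, so the
  \<open>card V - a\<close> vertices outside \<open>S\<close> supply all colours.\<close>

lemma robust_clique_number_imp_proper_coloring:
  assumes "finite V" "V \<noteq> {}"
    and max: "\<And>K. K \<subseteq> V \<Longrightarrow> clique K E \<Longrightarrow> card K \<le> a"
    and robust: "\<And>v. v \<in> V \<Longrightarrow> \<exists>K \<subseteq> V - {v}. clique K E \<and> card K = a"
  shows "\<exists>c. proper_coloring V E (card V - a) c"
proof -
  obtain S where S: "S \<subseteq> V" "clique S E" "card S = a"
    using robust \<open>V \<noteq> {}\<close> by blast
  define N where "N s = {u \<in> V - S. {s, u} \<notin> E}" for s
  have finS: "finite S" using S \<open>finite V\<close> finite_subset by blast
  have finN: "finite (\<Union>(N ` X))" for X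
    by (rule finite_subset[OF _ \<open>finite V\<close>]) (auto simp: N_def)
  have Hall: "card X \<le> card (\<Union>(N ` X))" if "X \<subseteq> S" for X
    using that
  proof (induction "card X" arbitrary: X rule: less_induct)
    case less
    have finX: "finite X" using less.prems finS finite_subset by blast
    show ?case
    proof (rule ccontr)
      assume viol: "\<not> ?thesis"
      then obtain x where x: "x \<in> X" by fastforce
      then obtain T where T: "T \<subseteq> V - {x}" "clique T E" "card T = a"
        using robust[of x] less.prems S(1) by blast
      have finT: "finite T" using T(1) \<open>finite V\<close> finite_subset by blast
      let ?N = "\<Union>(N ` X)" and ?Y = "X \<inter> T"
      \<comment> \<open>\<open>x\<close> lies in \<open>X\<close> but not in \<open>T\<close>, so
        \<open>?Y\<close> is smaller than \<open>X\<close> and the induction hypothesis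
        applies.\<close>
      have Y: "card ?Y \<le> card (\<Union>(N ` ?Y))"
        using x T(1) finX less.prems by (intro less.hyps psubset_card_mono) auto
      have disj: "\<Union>(N ` ?Y) \<inter> T = {}"
      proof -
        have False if "s \<in> ?Y" "u \<in> N s" "u \<in> T" for s u
        proof -
          have "s \<noteq> u" using that less.prems by (auto simp: N_def)
          then show False using that T(2) by (auto simp: N_def clique_def)
        qed
        then show ?thesis by blast
      qed
      have "card (T \<inter> ?N) + card (\<Union>(N ` ?Y)) = card ((T \<inter> ?N) \<union> \<Union>(N ` ?Y))"
        using disj finT finN by (subst card_Un_disjoint) auto
      also have "\<dots> \<le> card ?N" by (rule card_mono[OF finN]) auto
      finally have *: "card (T \<inter> ?N) + card ?Y < card X" using Y viol by linarith
      \<comment> \<open>\<open>?T'\<close> loses the members of \<open>T\<close> that miss some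
        vertex of \<open>X\<close>, fewer than \<open>card X - card ?Y\<close> of them by
        \<open>*\<close>, and gains \<open>card X - card ?Y\<close> new ones. It is therefore a
        clique larger than \<open>T\<close>.\<close>
      let ?T' = "(T - ?N) \<union> X"
      have "clique ?T' E"
      proof -
        have "{s, u} \<in> E" if "s \<in> X" "u \<in> T - ?N" "s \<noteq> u" for s u
        proof (cases "u \<in> S")
          case True
          then show ?thesis using S(2) that less.prems by (auto simp: clique_def)
        next
          case False
          then show ?thesis using that T(1) by (auto simp: N_def)
        qed
        moreover have "clique X E" using S(2) less.prems clique_subset by blast
        moreover have "clique (T - ?N) E" using T(2) clique_subset by blast
        ultimately show ?thesis
          unfolding clique_def by (metis UnE insert_commute)
      qed
      then have "card ?T' \<le> a"
        using T(1) less.prems S(1) by (intro max) auto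
      moreover have "card ?T' + card ?Y = card (T - ?N) + card X"
      proof -
        have "(T - ?N) \<inter> X = ?Y" using less.prems by (auto simp: N_def)
        then show ?thesis using card_Un_Int[of "T - ?N" X] finT finX by simp
      qed
      moreover have "card (T - ?N) + card (T \<inter> ?N) = a"
        using T(3) finT card_Int_Diff[of T ?N] by simp
      ultimately show False using * by linarith
    qed
  qed
  obtain f where f: "inj_on f S" "\<forall>s\<in>S. f s \<in> N s"
    using Hall_marriage[of S N] finS finN[of "{_}"] Hall by auto
  have "card (V - S) = card V - a"
    using S \<open>finite V\<close> card_Diff_subset finS by blast
  then obtain g where g: "bij_betw g (V - S) {..<card V - a}"
    using \<open>finite V\<close> by (metis card_lessThan finite_Diff finite_lessThan finite_same_card_bij)
  \<comment> \<open>Each colour class is one vertex outside \<open>S\<close>, together with its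
    matched non-neighbour in \<open>S\<close> if there is one.\<close>
  define c where "c v = g (if v \<in> S then f v else v)" for v
  have rep: "(if v \<in> S then f v else v) \<in> V - S" if "v \<in> V" for v
    using f(2) that by (auto simp: N_def)
  have "c u \<noteq> c v" if uv: "u \<in> V" "v \<in> V" "u \<noteq> v" "{u, v} \<in> E" for u v
  proof
    assume "c u = c v"
    then have eq: "(if u \<in> S then f u else u) = (if v \<in> S then f v else v)"
      using g rep uv(1,2) unfolding c_def bij_betw_def inj_on_def by blast
    show False
      using eq uv f by (auto simp: N_def inj_on_def insert_commute split: if_splits)
  qed
  moreover have "c \<in> V \<rightarrow> {..<card V - a}"
    using g rep unfolding c_def bij_betw_def by blast
  ultimately show ?thesis
    unfolding proper_coloring_def by blast
qed

text \<open>Merge all colours from \<open>r\<close> upwards into the last one. The classes below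
  \<open>r\<close> stay independent, so the merged class contains a \<open>p\<close>-clique, whose
  vertices have \<open>p\<close> distinct original colours in \<open>{r..<k}\<close>.\<close>

lemma arrows_twos_proper_coloring:
  assumes "vertex_arrows V E (replicate r 2 @ [p])" "proper_coloring V E k c" "p > 0"
  shows "r + p \<le> k"
proof (rule ccontr)
  assume k: "\<not> r + p \<le> k"
  define d where "d v = min (c v) r" for v
  have "d \<in> V \<rightarrow> {..r}" by (auto simp: d_def)
  moreover have "\<not> (\<exists>u\<in>V. \<exists>v\<in>V. u \<noteq> v \<and> {u, v} \<in> E \<and> d u = d v \<and> d u < r)"
    using assms(2) by (auto simp: proper_coloring_def d_def min_def split: if_splits)
  ultimately obtain K where K: "K \<in> nsets V p" "clique K E" "\<forall>v\<in>K. d v = r"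
    using assms(1) unfolding vertex_arrows_twos_iff by blast
  then have "K \<subseteq> V" by (auto simp: nsets_def)
  have "inj_on c K"
    using assms(2) K(2) \<open>K \<subseteq> V\<close> unfolding proper_coloring_def clique_def inj_on_def by blast
  moreover have "c ` K \<subseteq> {r..<k}"
  proof
    fix y assume "y \<in> c ` K"
    then obtain v where "v \<in> K" "y = c v" by blast
    moreover from this have "c v < k"
      using assms(2) \<open>K \<subseteq> V\<close> by (auto simp: proper_coloring_def)
    moreover have "r \<le> c v"
      using K(3) \<open>v \<in> K\<close> unfolding d_def by (metis min.cobounded1)
    ultimately show "y \<in> {r..<k}" by simp
  qed
  ultimately have "card K \<le> k - r" using card_inj_on_le[of c K "{r..<k}"] by simp
  \<comment> \<open>\<open>p > 0\<close> excludes the case \<open>k < r\<close>, where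
    \<open>k - r\<close> is truncated to 0.\<close>
  then show False using K(1) k assms(3) by (simp add: nsets_def)
qed

lemma arrows_twos_card:
  assumes "finite V" "vertex_arrows V E (replicate r 2 @ [p])" "p > 0"
  shows "r + p \<le> card V"
proof -
  obtain g where "bij_betw g V {..<card V}"
    using assms(1) by (metis card_lessThan finite_lessThan finite_same_card_bij)
  then have "proper_coloring V E (card V) g"
    unfolding proper_coloring_def bij_betw_def inj_on_def by blast
  then show ?thesis using arrows_twos_proper_coloring assms(2,3) by blast
qed

subsection \<open>Folkman graphs\<close>

text \<open>The condition minimised in \<open>vertex_Folkman\<close>, with an arbitrary vertex type
  so that joins can be formed on a sum type.\<close>

definition Folkman_graph :: "'a set \<Rightarrow> 'a set set \<Rightarrow> nat list \<Rightarrow> nat \<Rightarrow> bool" where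
  "Folkman_graph V E as q \<longleftrightarrow>
     simple_graph V E \<and> vertex_arrows V E as \<and> clique_number V E < q"

lemma Folkman_graph_card_clique_less:
  assumes "Folkman_graph V E as q" "K \<subseteq> V" "clique K E"
  shows "card K < q"
  using assms clique_number_less_iff[of V E q] by (auto simp: Folkman_graph_def simple_graph_def)

text \<open>Transport along an injection serves two ends: moving a graph to vertices in
  \<open>nat\<close>, and making two vertex sets disjoint.\<close>

lemma Folkman_graph_image:
  fixes f :: "'a \<Rightarrow> 'b"
  assumes G: "Folkman_graph V E as q" and f: "inj_on f V"
  shows "Folkman_graph (f ` V) ((`) f ` E) as q"
proof -
  have fin: "finite V" and E: "E \<subseteq> nsets V 2"
    using G by (auto simp: Folkman_graph_def simple_graph_def)
  \<comment> \<open>\<open>f\<close> is injective only on \<open>V\<close>, so the forward direction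
    relies on every edge lying inside \<open>V\<close>.\<close>
  have edge: "f ` {u, v} \<in> (`) f ` E \<longleftrightarrow> {u, v} \<in> E" if "u \<in> V" "v \<in> V" for u v
  proof
    assume "f ` {u, v} \<in> (`) f ` E"
    then obtain e where e: "e \<in> E" "f ` e = f ` {u, v}" by auto
    then have "e \<subseteq> V" using E by (auto simp: nsets_def)
    then have "e = {u, v}"
      using inj_on_image_eq_iff[OF f, of e "{u, v}"] that e(2) by blast
    then show "{u, v} \<in> E" using e(1) by simp
  qed blast
  have cl: "clique (f ` K) ((`) f ` E) \<longleftrightarrow> clique K E" if "K \<subseteq> V" for K
  proof -
    have "f u = f v \<longleftrightarrow> u = v" "{f u, f v} \<in> (`) f ` E \<longleftrightarrow> {u, v} \<in> E" if "u \<in> K" "v \<in> K" for u v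
      using that \<open>K \<subseteq> V\<close> edge[of u v] inj_on_eq_iff[OF f, of u v] by auto
    then show ?thesis unfolding clique_def by auto
  qed
  have card: "card (f ` K) = card K" if "K \<subseteq> V" for K
    using f that card_image inj_on_subset by blast
  have "simple_graph (f ` V) ((`) f ` E)"
  proof -
    have "f ` e \<in> nsets (f ` V) 2" if "e \<in> E" for e
      using that E card[of e] by (auto simp: nsets_def)
    then show ?thesis using fin by (auto simp: simple_graph_def)
  qed
  moreover have "vertex_arrows (f ` V) ((`) f ` E) as"
    unfolding vertex_arrows_def
  proof
    fix c assume "c \<in> f ` V \<rightarrow> {..<length as}"
    then have "c \<circ> f \<in> V \<rightarrow> {..<length as}" by auto
    then obtain i K where i: "i < length as" "K \<in> nsets V (as ! i)" "clique K E"
        "\<forall>v\<in>K. (c \<circ> f) v = i"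
      using G unfolding Folkman_graph_def vertex_arrows_def by blast
    then have "f ` K \<in> nsets (f ` V) (as ! i)"
      using card[of K] by (auto simp: nsets_def)
    moreover have "clique (f ` K) ((`) f ` E)" using i cl[of K] by (auto simp: nsets_def)
    ultimately show "\<exists>i<length as. \<exists>K\<in>nsets (f ` V) (as ! i). clique K ((`) f ` E) \<and> (\<forall>v\<in>K. c v = i)"
      using i by (intro exI[of _ i] conjI bexI[of _ "f ` K"]) auto
  qed
  moreover have "clique_number (f ` V) ((`) f ` E) < q"
    using G fin cl card
    by (auto simp: Folkman_graph_def clique_number_less_iff subset_image_iff)
  ultimately show ?thesis by (simp add: Folkman_graph_def)
qed

lemma vertex_Folkman_le:
  assumes "Folkman_graph V E as q"
  shows "vertex_Folkman as q \<le> card V"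
proof -
  have "finite V" using assms by (simp add: Folkman_graph_def simple_graph_def)
  then obtain f where f: "bij_betw f V {0..<card V}"
    using ex_bij_betw_finite_nat by blast
  then have "Folkman_graph {0..<card V} ((`) f ` E) as q"
    using Folkman_graph_image[OF assms, of f] by (simp add: bij_betw_def)
  then show ?thesis
    unfolding vertex_Folkman_def Folkman_graph_def
    by (intro Least_le) (metis card_atLeastLessThan diff_zero)
qed

text \<open>\<open>LEAST\<close> yields an actual minimum only once some graph with the property is
  known; that graph may have any vertex type.\<close>

lemma vertex_Folkman_attained:
  assumes "Folkman_graph (V :: 'a set) E as q"
  obtains W :: "nat set" and F where "Folkman_graph W F as q" "card W = vertex_Folkman as q"
proof -
  have "finite V" using assms by (simp add: Folkman_graph_def simple_graph_def)
  then obtain f :: "'a \<Rightarrow> nat" where "inj_on f V"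
    using finite_imp_inj_to_nat_seg[of V] by auto
  then have "Folkman_graph (f ` V) ((`) f ` E) as q"
    using Folkman_graph_image[OF assms] by blast
  then have "\<exists>n. \<exists>(V :: nat set) E. simple_graph V E \<and> card V = n \<and>
        vertex_arrows V E as \<and> clique_number V E < q"
    unfolding Folkman_graph_def by blast
  from LeastI_ex[OF this] obtain W :: "nat set" and F where
    "simple_graph W F" "card W = vertex_Folkman as q" "vertex_arrows W F as" "clique_number W F < q"
    unfolding vertex_Folkman_def by blast
  then show ?thesis using that unfolding Folkman_graph_def by blast
qed

section \<open>Joins and universal vertices\<close>

text \<open>A colouring of the join without an edge in a class below \<open>r\<close> has none in
  either part. The parts thus contain a \<open>p\<close>-clique and a \<open>q\<close>-clique of
  colour \<open>r\<close>, and their union is a clique of the join. The bounds on clique sizes add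
  up in the same way.\<close>

lemma Folkman_graph_join:
  assumes G: "Folkman_graph V E (replicate r 2 @ [p]) (p + 1)"
    and H: "Folkman_graph W F (replicate r 2 @ [q]) (q + 1)"
    and disj: "V \<inter> W = {}"
  shows "Folkman_graph (V \<union> W) (E \<union> F \<union> {{u, w} |u w. u \<in> V \<and> w \<in> W})
    (replicate r 2 @ [p + q]) (p + q + 1)"
proof -
  let ?J = "E \<union> F \<union> {{u, w} |u w. u \<in> V \<and> w \<in> W}"
  have fin: "finite V" "finite W" and E: "E \<subseteq> nsets V 2" and F: "F \<subseteq> nsets W 2"
    using G H by (auto simp: Folkman_graph_def simple_graph_def)
  have "{u, w} \<in> nsets (V \<union> W) 2" if "u \<in> V" "w \<in> W" for u w
    using that disj by (auto simp: nsets_def card_insert_if)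
  then have "simple_graph (V \<union> W) ?J"
    using fin E F by (auto simp: simple_graph_def nsets_def)
  moreover have "vertex_arrows (V \<union> W) ?J (replicate r 2 @ [p + q])"
    unfolding vertex_arrows_twos_iff
  proof (intro ballI disj_imp[THEN iffD2] impI)
    fix c assume c: "c \<in> V \<union> W \<rightarrow> {..r}"
      and no: "\<not> (\<exists>u\<in>V \<union> W. \<exists>v\<in>V \<union> W. u \<noteq> v \<and> {u, v} \<in> ?J \<and> c u = c v \<and> c u < r)"
    obtain K where K: "K \<in> nsets V p" "clique K E" "\<forall>v\<in>K. c v = r"
    proof -
      have "c \<in> V \<rightarrow> {..r}" using c by auto
      moreover have "\<not> (\<exists>u\<in>V. \<exists>v\<in>V. u \<noteq> v \<and> {u, v} \<in> E \<and> c u = c v \<and> c u < r)"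
        using no by blast
      ultimately show ?thesis
        using G that unfolding Folkman_graph_def vertex_arrows_twos_iff by blast
    qed
    obtain L where L: "L \<in> nsets W q" "clique L F" "\<forall>v\<in>L. c v = r"
    proof -
      have "c \<in> W \<rightarrow> {..r}" using c by auto
      moreover have "\<not> (\<exists>u\<in>W. \<exists>v\<in>W. u \<noteq> v \<and> {u, v} \<in> F \<and> c u = c v \<and> c u < r)"
        using no by blast
      ultimately show ?thesis
        using H that unfolding Folkman_graph_def vertex_arrows_twos_iff by blast
    qed
    have KL: "K \<subseteq> V" "L \<subseteq> W" using K(1) L(1) by (auto simp: nsets_def)
    have "K \<inter> L = {}" using KL disj by blast
    then have "K \<union> L \<in> nsets (V \<union> W) (p + q)"
      using K(1) L(1) by (auto simp: nsets_def card_Un_disjoint)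
    moreover have "clique (K \<union> L) ?J"
      unfolding clique_def
    proof (intro ballI impI)
      fix u v assume uv: "u \<in> K \<union> L" "v \<in> K \<union> L" "u \<noteq> v"
      then consider "u \<in> K" "v \<in> K" | "u \<in> L" "v \<in> L" | "u \<in> K" "v \<in> L" | "u \<in> L" "v \<in> K"
        by blast
      then show "{u, v} \<in> ?J"
      proof cases
        case 1
        then show ?thesis using K(2) uv(3) by (auto simp: clique_def)
      next
        case 2
        then show ?thesis using L(2) uv(3) by (auto simp: clique_def)
      next
        case 3
        then show ?thesis using KL by blast
      next
        case 4
        then have "{v, u} \<in> ?J" using KL by blast
        then show ?thesis by (simp only: insert_commute)
      qed
    qed
    ultimately show "\<exists>K\<in>nsets (V \<union> W) (p + q). clique K ?J \<and> (\<forall>v\<in>K. c v = r)"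
      using K(3) L(3) by (intro bexI[of _ "K \<union> L"]) auto
  qed
  moreover have "card K < p + q + 1" if K: "K \<subseteq> V \<union> W" "clique K ?J" for K
  proof -
    have "{u, v} \<in> E" if "u \<in> K \<inter> V" "v \<in> K \<inter> V" "{u, v} \<in> ?J" for u v
      using that disj F by (auto simp: doubleton_eq_iff nsets_def)
    then have "clique (K \<inter> V) E"
      by (intro clique_change_edges[OF K(2)]) simp_all
    moreover have "{u, v} \<in> F" if "u \<in> K \<inter> W" "v \<in> K \<inter> W" "{u, v} \<in> ?J" for u v
      using that disj E by (auto simp: doubleton_eq_iff nsets_def)
    then have "clique (K \<inter> W) F"
      by (intro clique_change_edges[OF K(2)]) simp_all
    ultimately have "card (K \<inter> V) < p + 1" "card (K \<inter> W) < q + 1"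
      using G H fin by (auto simp: Folkman_graph_def clique_number_less_iff)
    moreover have "card K = card (K \<inter> V) + card (K \<inter> W)"
      using K(1) fin disj by (subst card_Un_disjoint[symmetric]) (auto intro!: arg_cong[of _ _ card])
    ultimately show ?thesis by simp
  qed
  ultimately show ?thesis
    using fin by (simp add: Folkman_graph_def clique_number_less_iff)
qed

text \<open>If \<open>v\<close> has one of the first \<open>Suc r\<close> colours and no edge is
  monochromatic in such a colour, that colour is absent from \<open>V\<close>, which leaves only
  \<open>r\<close> independent classes there. If \<open>v\<close> has the last colour,
  \<open>v\<close> can replace the one vertex that a clique may lose.\<close>

lemma Folkman_graph_add_universal_vertex:
  assumes G: "Folkman_graph V E (replicate r 2 @ [p]) q" and v: "v \<notin> V" and "p > 0"
  shows "Folkman_graph (insert v V) (E \<union> {{v, u} |u. u \<in> V}) (replicate (Suc r) 2 @ [p]) (Suc q)"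
proof -
  let ?V = "insert v V" and ?E = "E \<union> {{v, u} |u. u \<in> V}"
  have fin: "finite V" and E: "E \<subseteq> nsets V 2"
    using G by (auto simp: Folkman_graph_def simple_graph_def)
  have arrow: "(\<exists>u\<in>V. \<exists>w\<in>V. u \<noteq> w \<and> {u, w} \<in> E \<and> d u = d w \<and> d u < r) \<or>
      (\<exists>K \<in> nsets V p. clique K E \<and> (\<forall>w\<in>K. d w = r))" if "d \<in> V \<rightarrow> {..r}" for d
    using G that unfolding Folkman_graph_def vertex_arrows_twos_iff by blast
  have "{v, u} \<in> nsets ?V 2" if "u \<in> V" for u
    using that v by (auto simp: nsets_def card_insert_if)
  then have "simple_graph ?V ?E"
    using fin E by (auto simp: simple_graph_def nsets_def)
  moreover have "vertex_arrows ?V ?E (replicate (Suc r) 2 @ [p])"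
    unfolding vertex_arrows_twos_iff
  proof (intro ballI disj_imp[THEN iffD2] impI)
    fix c assume c: "c \<in> ?V \<rightarrow> {..Suc r}"
      and no: "\<not> (\<exists>u\<in>?V. \<exists>w\<in>?V. u \<noteq> w \<and> {u, w} \<in> ?E \<and> c u = c w \<and> c u < Suc r)"
    have no_edge: False if "u \<in> V" "w \<in> V" "u \<noteq> w" "{u, w} \<in> E" "c u = c w" "c u < Suc r" for u w
      using no that by blast
    have no_v: False if "u \<in> V" "c u = c v" "c v < Suc r" for u
    proof -
      have "{v, u} \<in> ?E" "v \<noteq> u" using that(1) v by auto
      then have "\<exists>u\<in>?V. \<exists>w\<in>?V. u \<noteq> w \<and> {u, w} \<in> ?E \<and> c u = c w \<and> c u < Suc r"
        using that by (intro bexI[of _ v] bexI[of _ u] conjI) simp_all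
      then show False using no by contradiction
    qed
    have c_le: "c u \<le> Suc r" if "u \<in> ?V" for u using c that by auto
    show "\<exists>K\<in>nsets ?V p. clique K ?E \<and> (\<forall>u\<in>K. c u = Suc r)"
    proof (cases "c v = Suc r")
      case False
      then have cv: "c v < Suc r" using c_le[of v] by simp
      \<comment> \<open>The colour of \<open>v\<close> does not occur on \<open>V\<close>, so it can take over the role of colour \<open>r\<close>.\<close>
      define d where "d u = (if c u = Suc r then r else if c u = r then c v else c u)" for u
      have "d u \<le> r" if "u \<in> V" for u
        using c_le[of u] cv that by (auto simp: d_def)
      moreover have lt: "d u < r \<longleftrightarrow> c u < Suc r" if "u \<in> V" for u
      proof -
        have "c v \<noteq> c u" using no_v[of u] cv that by auto
        then show ?thesis using c_le[of u] cv that by (auto simp: d_def)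
      qed
      moreover have "c u = c w" if "u \<in> V" "w \<in> V" "d u = d w" "d u < r" for u w
      proof -
        have "d w < r" using that(3,4) by simp
        then have "c u < Suc r" "c w < Suc r"
          using that lt[of u] lt[of w] by simp_all
        moreover have "c v \<noteq> c u" "c v \<noteq> c w"
          using no_v[of u] no_v[of w] cv that by auto
        ultimately show ?thesis using that(3) by (auto simp: d_def split: if_splits)
      qed
      ultimately obtain K where K: "K \<in> nsets V p" "clique K E" "\<forall>u\<in>K. d u = r"
        using arrow[of d] no_edge by (metis Pi_I atMost_iff)
      have "c u = Suc r" if "u \<in> K" for u
      proof -
        have "u \<in> V" using K(1) that by (auto simp: nsets_def)
        then show ?thesis using K(3) that lt[of u] c_le[of u] by force
      qed
      then show ?thesis
        using K by (intro bexI[of _ K]) (auto simp: nsets_def clique_def)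
    next
      case True
      \<comment> \<open>The last independent class, of colour \<open>r\<close>, is merged with the
        clique colour \<open>Suc r\<close>.\<close>
      define d where "d u = min (c u) r" for u
      have "\<not> (\<exists>u\<in>V. \<exists>w\<in>V. u \<noteq> w \<and> {u, w} \<in> E \<and> d u = d w \<and> d u < r)"
      proof
        assume "\<exists>u\<in>V. \<exists>w\<in>V. u \<noteq> w \<and> {u, w} \<in> E \<and> d u = d w \<and> d u < r"
        then obtain u w where "u \<in> V" "w \<in> V" "u \<noteq> w" "{u, w} \<in> E" "d u = d w" "d u < r"
          by blast
        then show False
          using no_edge[of u w] by (simp add: d_def min_def split: if_splits)
      qed
      moreover have "d \<in> V \<rightarrow> {..r}" by (simp add: d_def)
      ultimately obtain K where K: "K \<in> nsets V p" "clique K E" "\<forall>u\<in>K. d u = r"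
        using arrow by blast
      have KV: "K \<subseteq> V" "finite K" "card K = p" using K(1) by (auto simp: nsets_def)
      have cK: "c u = r \<or> c u = Suc r" if "u \<in> K" for u
        using K(3) KV(1) c_le[of u] that by (force simp: d_def min_def split: if_splits)
      \<comment> \<open>Colour \<open>r\<close> is an independent class of \<open>c\<close>, so at
        most one vertex of the clique \<open>K\<close> has it; \<open>v\<close> stands in for that
        vertex.\<close>
      let ?R = "{u \<in> K. c u = r}" and ?L = "{u \<in> K. c u = Suc r}"
      have "card ?R \<le> Suc 0"
      proof -
        have "u = w" if "u \<in> ?R" "w \<in> ?R" for u w
          using that no_edge[of u w] K(2) KV(1) by (auto simp: clique_def)
        then show ?thesis using KV(2) by (subst card_le_Suc0_iff_eq) auto
      qed
      moreover have "K = ?R \<union> ?L" using cK by blast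
      then have "p \<le> card ?R + card ?L" using KV(3) card_Un_le[of ?R ?L] by simp
      moreover have "card (insert v ?L) = Suc (card ?L)"
        using KV v by (subst card_insert_disjoint) auto
      ultimately have "p \<le> card (insert v ?L)" by simp
      then obtain M where M: "M \<subseteq> insert v ?L" "card M = p" "finite M"
        using obtain_subset_with_card_n by blast
      have "clique (insert v ?L) ?E"
        using K(2) KV(1) by (auto simp: clique_insert clique_def)
      then have "clique M ?E" using M(1) clique_subset by blast
      moreover have "M \<in> nsets ?V p" using M KV(1) by (auto simp: nsets_def)
      moreover have "\<forall>u\<in>M. c u = Suc r" using M(1) True by auto
      ultimately show ?thesis by blast
    qed
  qed
  moreover have "card K < Suc q" if K: "K \<subseteq> ?V" "clique K ?E" for K
  proof -
    have "{u, w} \<in> E" if "u \<in> K - {v}" "w \<in> K - {v}" "{u, w} \<in> ?E" for u w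
      using that v K(1) by (auto simp: doubleton_eq_iff)
    then have "clique (K - {v}) E"
      by (intro clique_change_edges[OF K(2)]) auto
    moreover have "K - {v} \<subseteq> V" using K(1) by auto
    ultimately have "card (K - {v}) < q"
      by (rule Folkman_graph_card_clique_less[OF G, rotated])
    then show ?thesis using card_Diff_singleton_if[of K v] by (simp split: if_splits)
  qed
  ultimately show ?thesis
    using fin by (simp add: Folkman_graph_def clique_number_less_iff)
qed

subsection \<open>Three small graphs\<close>

text \<open>Sets of vertices below \<open>m\<close> are represented by Boolean lists whose head belongs to vertex
  \<open>m - 1\<close>, so that the row of a new vertex lines up with the colour classes built so far. Nested
  conditionals replace connectives because only they are evaluated lazily by \<open>code_simp\<close>.\<close>

fun has_clique :: "nat \<Rightarrow> bool list \<Rightarrow> bool list list \<Rightarrow> bool" where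
  "has_clique 0 ms rs = True"
| "has_clique (Suc k) (m # ms) (r # rs) =
     (if (if m then has_clique k (map2 (\<and>) ms r) rs else False) then True
      else has_clique (Suc k) ms rs)"
| "has_clique (Suc k) [] rs = False"
| "has_clique (Suc k) ms [] = False"

fun meets :: "bool list \<Rightarrow> bool list \<Rightarrow> bool" where
  "meets (a # as) (b # bs) = (if a \<and> b then True else meets as bs)"
| "meets [] bs = False"
| "meets as [] = False"

fun arrow_search ::
  "nat \<Rightarrow> bool list list \<Rightarrow> bool list list \<Rightarrow> bool list \<Rightarrow> bool list \<Rightarrow> bool list \<Rightarrow> bool" where
  "arrow_search p [] rs A B C = False"
| "arrow_search p (r # todo) rs A B C =
     (if (if meets A r then True
          else arrow_search p todo (r # rs) (True # A) (False # B) (False # C))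
      then if (if meets B r then True
               else arrow_search p todo (r # rs) (False # A) (True # B) (False # C))
      then if has_clique (p - 1) (map2 (\<and>) C r) rs then True
           else arrow_search p todo (r # rs) (False # A) (False # B) (True # C)
      else False else False)"

definition adj_row :: "(nat \<Rightarrow> nat \<Rightarrow> bool) \<Rightarrow> nat \<Rightarrow> bool list" where
  "adj_row adj i = map (adj i) (rev [0..<i])"

definition adj_rows :: "(nat \<Rightarrow> nat \<Rightarrow> bool) \<Rightarrow> nat \<Rightarrow> bool list list" where
  "adj_rows adj n = map (adj_row adj) (rev [0..<n])"

text \<open>\<open>adj\<close> is read only with the larger vertex first. The difference
  \<open>i - j\<close> is then never truncated, and a circulant graph has to list both residues
  \<open>d\<close> and \<open>n - d\<close> of a distance.\<close>

definition edges_below :: "(nat \<Rightarrow> nat \<Rightarrow> bool) \<Rightarrow> nat \<Rightarrow> nat set set" where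
  "edges_below adj n = {{i, j} |i j. j < i \<and> i < n \<and> adj i j}"

lemma edges_below_iff: "j < i \<Longrightarrow> i < n \<Longrightarrow> {i, j} \<in> edges_below adj n \<longleftrightarrow> adj i j"
  by (auto simp: edges_below_def doubleton_eq_iff)

section \<open>Correctness of the search\<close>

lemma simple_graph_edges_below: "simple_graph {..<n} (edges_below adj n)"
  by (auto simp: simple_graph_def edges_below_def nsets_def)

lemma meets_map: "meets (map P xs) (map Q xs) \<longleftrightarrow> (\<exists>x\<in>set xs. P x \<and> Q x)"
  by (induction xs) auto

lemma map2_conj_map: "map2 (\<and>) (map P xs) (map Q xs) = map (\<lambda>x. P x \<and> Q x) xs"
  by (induction xs) auto

text \<open>Induction on \<open>m\<close>, splitting the cliques by whether they contain the newest
  vertex \<open>m\<close>. The edge set stays that of the whole graph on \<open>n\<close> vertices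
  while \<open>m\<close> grows.\<close>

lemma has_clique_iff:
  assumes "m \<le> n"
  shows "has_clique k (map P (rev [0..<m])) (adj_rows adj m) \<longleftrightarrow>
    (\<exists>K \<subseteq> {..<m}. card K = k \<and> clique K (edges_below adj n) \<and> (\<forall>v\<in>K. P v))"
  using assms
proof (induction m arbitrary: k P)
  case 0
  then show ?case
    by (cases k) (auto simp: adj_rows_def clique_def)
next
  case (Suc m)
  show ?case
  proof (cases k)
    case 0
    then show ?thesis by (auto intro!: exI[of _ "{}"] simp: clique_def)
  next
    case (Suc k')
    let ?E = "edges_below adj n"
    have IH: "has_clique j (map Q (rev [0..<m])) (adj_rows adj m) \<longleftrightarrow>
        (\<exists>K \<subseteq> {..<m}. card K = j \<and> clique K ?E \<and> (\<forall>v\<in>K. Q v))" for j Q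
      using Suc.IH Suc.prems by simp
    have "has_clique k (map P (rev [0..<Suc m])) (adj_rows adj (Suc m)) \<longleftrightarrow>
        P m \<and> has_clique k' (map (\<lambda>v. P v \<and> adj m v) (rev [0..<m])) (adj_rows adj m) \<or>
        has_clique k (map P (rev [0..<m])) (adj_rows adj m)"
      using Suc by (simp add: adj_rows_def adj_row_def map2_conj_map)
    also have "\<dots> \<longleftrightarrow>
        (P m \<and> (\<exists>K \<subseteq> {..<m}. card K = k' \<and> clique K ?E \<and> (\<forall>v\<in>K. P v \<and> adj m v))) \<or>
        (\<exists>K \<subseteq> {..<m}. card K = k \<and> clique K ?E \<and> (\<forall>v\<in>K. P v))"
      unfolding IH ..
    also have "\<dots> \<longleftrightarrow> (\<exists>K \<subseteq> {..<Suc m}. card K = k \<and> clique K ?E \<and> (\<forall>v\<in>K. P v))" (is "?L \<longleftrightarrow> ?R")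
    proof
      assume ?L
      then show ?R
      proof (elim disjE conjE exE)
        fix K assume K: "P m" "K \<subseteq> {..<m}" "card K = k'" "clique K ?E" "\<forall>v\<in>K. P v \<and> adj m v"
        then have "clique (insert m K) ?E"
          using Suc.prems by (auto simp: clique_insert edges_below_iff)
        moreover have "card (insert m K) = k"
          using K Suc finite_subset[OF K(2)] by (subst card_insert_disjoint) auto
        ultimately show ?R
          using K by (intro exI[of _ "insert m K"]) auto
      next
        fix K assume "K \<subseteq> {..<m}" "card K = k" "clique K ?E" "\<forall>v\<in>K. P v"
        then show ?R by (intro exI[of _ K]) auto
      qed
    next
      assume ?R
      then obtain K where K: "K \<subseteq> {..<Suc m}" "card K = k" "clique K ?E" "\<forall>v\<in>K. P v"
        by blast
      show ?L
      proof (cases "m \<in> K")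
        case True
        have sub: "K - {m} \<subseteq> {..<m}" using K(1) by (auto simp: less_Suc_eq)
        moreover have "adj m v" if "v \<in> K - {m}" for v
        proof -
          have "{m, v} \<in> ?E" using K(3) True that by (auto simp: clique_def)
          then show ?thesis
            using edges_below_iff[of v m n adj] Suc.prems sub that by auto
        qed
        moreover have "card (K - {m}) = k'" using True K(2) Suc by simp
        ultimately show ?thesis
          using K True clique_subset[of K ?E "K - {m}"]
          by (intro disjI1 conjI exI[of _ "K - {m}"]) auto
      next
        case False
        then have "K \<subseteq> {..<m}" using K(1) by (auto simp: less_Suc_eq)
        then show ?thesis using K by blast
      qed
    qed
    finally show ?thesis .
  qed
qed

text \<open>Trades the conditionals, which are there for lazy evaluation, for connectives fit for
  reasoning.\<close>

lemma arrow_search_Cons: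
  "arrow_search p (r # todo) rs A B C \<longleftrightarrow>
     (meets A r \<or> arrow_search p todo (r # rs) (True # A) (False # B) (False # C)) \<and>
     (meets B r \<or> arrow_search p todo (r # rs) (False # A) (True # B) (False # C)) \<and>
     (has_clique (p - 1) (map2 (\<and>) C r) rs \<or>
       arrow_search p todo (r # rs) (False # A) (False # B) (True # C))"
  by simp

text \<open>Follow the branch of the search that colours every vertex as \<open>c\<close> does:
  either it is cut at vertex \<open>m\<close>, which exhibits an edge or a clique through
  \<open>m\<close>, or the search goes on with \<open>Suc m\<close>. With no vertex left the search
  returns \<open>False\<close>, contrary to the assumption.\<close>

lemma arrow_search_sound:
  fixes c :: "nat \<Rightarrow> nat"
  assumes "p > 0"
    and "m \<le> n" "c \<in> {..<n} \<rightarrow> {..2}"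
    and "arrow_search p (map (adj_row adj) [m..<n]) (adj_rows adj m)
      (map (\<lambda>j. c j = 0) (rev [0..<m])) (map (\<lambda>j. c j = 1) (rev [0..<m]))
      (map (\<lambda>j. c j = 2) (rev [0..<m]))"
  shows "(\<exists>u\<in>{..<n}. \<exists>v\<in>{..<n}. u \<noteq> v \<and> {u, v} \<in> edges_below adj n \<and> c u = c v \<and> c u < 2) \<or>
        (\<exists>K \<in> nsets {..<n} p. clique K (edges_below adj n) \<and> (\<forall>v\<in>K. c v = 2))"
    (is ?concl)
  using assms(2,4)
proof (induction "n - m" arbitrary: m)
  case 0
  then show ?case by simp
next
  case (Suc l)
  let ?mask = "\<lambda>m (i::nat). map (\<lambda>j. c j = i) (rev [0..<m])"
  have m: "m < n" using Suc.hyps(2) by simp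
  have next_step: ?concl
    if "arrow_search p (map (adj_row adj) [Suc m..<n]) (adj_rows adj (Suc m))
      (?mask (Suc m) 0) (?mask (Suc m) 1) (?mask (Suc m) 2)"
    by (rule Suc.hyps(1)[OF _ _ that]) (use Suc.hyps(2) m in simp_all)
  have edge: ?concl if i: "i < 2" "c m = i" "meets (?mask m i) (adj_row adj m)" for i
  proof -
    obtain j where "j < m" "c j = i" "adj m j"
      using i(3) unfolding adj_row_def meets_map by auto
    then show ?thesis
      using m i edges_below_iff[of j m n adj] by (intro disjI1 bexI[of _ m] bexI[of _ j]) auto
  qed
  have clique: ?concl
    if c: "c m = 2" "has_clique (p - 1) (map2 (\<and>) (?mask m 2) (adj_row adj m)) (adj_rows adj m)"
  proof -
    \<comment> \<open>A clique of size \<open>p - 1\<close> among the neighbours of \<open>m\<close>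
      of colour 2; adding \<open>m\<close> gives size \<open>p\<close> because
      \<open>p > 0\<close>.\<close>
    obtain K where K: "K \<subseteq> {..<m}" "card K = p - 1" "clique K (edges_below adj n)"
        "\<forall>v\<in>K. c v = 2 \<and> adj m v"
      using c(2) m has_clique_iff[of m n "p - 1" "\<lambda>j. c j = 2 \<and> adj m j" adj]
      unfolding adj_row_def map2_conj_map by auto
    then have "clique (insert m K) (edges_below adj n)"
      using m by (auto simp: clique_insert edges_below_iff)
    moreover have "m \<notin> K" using K(1) by auto
    then have "insert m K \<in> nsets {..<n} p"
      using K m \<open>p > 0\<close> finite_subset[OF K(1)] by (auto simp: nsets_def)
    ultimately show ?thesis using K c(1) by blast
  qed
  have upt: "[m..<n] = m # [Suc m..<n]" using m by (simp add: upt_conv_Cons)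
  have mask: "?mask (Suc m) i = (c m = i) # ?mask m i" for i
    by simp
  have rows: "adj_rows adj (Suc m) = adj_row adj m # adj_rows adj m"
    by (simp add: adj_rows_def)
  note search = Suc.prems(2)[unfolded upt list.map arrow_search_Cons]
  let ?continue = "arrow_search p (map (adj_row adj) [Suc m..<n]) (adj_rows adj (Suc m))
      (?mask (Suc m) 0) (?mask (Suc m) 1) (?mask (Suc m) 2)"
  consider (zero) "c m = 0" | (one) "c m = 1" | (two) "c m = 2"
    using assms(3) m by (force simp: Pi_iff)
  then show ?case
  proof cases
    case zero
    then have "meets (?mask m 0) (adj_row adj m) \<or> ?continue"
      using search unfolding rows mask by simp
    then show ?thesis
      by (elim disjE) (rule edge[OF _ zero], simp, assumption, rule next_step)
  next
    case one
    then have "meets (?mask m 1) (adj_row adj m) \<or> ?continue"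
      using search unfolding rows mask by simp
    then show ?thesis
      by (elim disjE) (rule edge[OF _ one], simp, assumption, rule next_step)
  next
    case two
    then have "has_clique (p - 1) (map2 (\<and>) (?mask m 2) (adj_row adj m)) (adj_rows adj m) \<or> ?continue"
      using search unfolding rows mask by simp
    then show ?thesis
      by (elim disjE) (rule clique[OF two], assumption, rule next_step)
  qed
qed

text \<open>Leaves two conditions to evaluate: no \<open>Suc p\<close>-clique, and no colouring that
  survives the search. The mask of the former is constant, so the order of its entries is
  immaterial.\<close>

lemma graph_by_search:
  assumes "p > 0"
    and "\<not> has_clique (Suc p) (map (\<lambda>_. True) [0..<n]) (adj_rows adj n)"
    and "arrow_search p (map (adj_row adj) [0..<n]) [] [] [] []"
  shows "\<exists>(V :: nat set) E. Folkman_graph V E [2, 2, p] (p + 1) \<and> card V = n"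
  unfolding Folkman_graph_def
proof (intro exI conjI)
  let ?E = "edges_below adj n"
  show "simple_graph {..<n} ?E" by (rule simple_graph_edges_below)
  show "vertex_arrows {..<n} ?E [2, 2, p]"
    using vertex_arrows_twos_iff[of "{..<n}" ?E 2 p] arrow_search_sound[of p 0 n _ adj] assms(1,3)
    by (simp add: numeral_2_eq_2 adj_rows_def)
  have "card K < p + 1" if K: "K \<subseteq> {..<n}" "clique K ?E" for K
  proof (rule ccontr)
    assume "\<not> card K < p + 1"
    then obtain L where "L \<subseteq> K" "card L = Suc p"
      using obtain_subset_with_card_n[of "Suc p" K] by auto
    then have "has_clique (Suc p) (map (\<lambda>_. True) (rev [0..<n])) (adj_rows adj n)"
      using has_clique_iff[of n n "Suc p" "\<lambda>_. True" adj] clique_subset K by blast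
    then show False using assms(2) by (simp add: map_replicate_const)
  qed
  then show "clique_number {..<n} ?E < p + 1"
    by (simp add: clique_number_less_iff)
qed simp

text \<open>The circulant graph on \<open>\<int>/13\<close> with distances 2 and 3.\<close>

lemma graph_2_2_2: "\<exists>(V :: nat set) E. Folkman_graph V E [2, 2, 2] (2 + 1) \<and> card V = 13"
  by (rule graph_by_search[where adj = "\<lambda>i j. i - j \<in> set [2, 3, 10, 11]"]) (simp, code_simp+)

text \<open>The Paley graph on 17 vertices.\<close>

lemma graph_2_2_3: "\<exists>(V :: nat set) E. Folkman_graph V E [2, 2, 3] (3 + 1) \<and> card V = 17"
  by (rule graph_by_search[where adj = "\<lambda>i j. i - j \<in> set [1, 2, 4, 8, 9, 13, 15, 16]"])
    (simp, code_simp+)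

text \<open>The lists are the lower neighbours in the complement, a triangle-free graph with a
  symmetry of order 4 that was found by computer search.\<close>

lemma graph_2_2_5: "\<exists>(V :: nat set) E. Folkman_graph V E [2, 2, 5] (5 + 1) \<and> card V = 16"
  by (rule graph_by_search[where adj = "\<lambda>i j. j \<notin> set ([[], [], [], [], [], [0], [2], [3],
        [0, 1, 6], [1, 2, 3], [1, 5, 7], [0, 1, 2, 7], [0, 4, 6, 9], [2, 3, 4, 10], [4, 5, 7, 8],
        [3, 4, 5, 6]] ! i)"])
    (simp, code_simp+)

subsection \<open>The minimum over the number of twos\<close>

text \<open>Strong induction in steps of two: the graph for \<open>p - 2\<close> is joined with the
  one for 2, starting from the explicit graphs for 2 and 3.\<close>

lemma Folkman_graph_exists:
  assumes "p \<ge> 2"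
  shows "\<exists>(V :: nat set) E. Folkman_graph V E (replicate 2 2 @ [p]) (p + 1)"
  using assms
proof (induction p rule: less_induct)
  case (less p)
  have two: "replicate 2 2 @ [k] = [2, 2, k]" for k :: nat by (simp add: numeral_2_eq_2)
  consider "p = 2" | "p = 3" | "p \<ge> 4" using less.prems by linarith
  then show ?case
  proof cases
    case 1
    then show ?thesis using graph_2_2_2 unfolding two by blast
  next
    case 2
    then show ?thesis using graph_2_2_3 unfolding two by blast
  next
    case 3
    obtain V :: "nat set" and E where G: "Folkman_graph V E (replicate 2 2 @ [2]) (2 + 1)"
      using graph_2_2_2 unfolding two by blast
    have "p - 2 < p" "2 \<le> p - 2" using 3 by auto
    then obtain W :: "nat set" and F where
      H: "Folkman_graph W F (replicate 2 2 @ [p - 2]) (p - 2 + 1)"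
      using less.IH by blast
    \<comment> \<open>The sum type makes the vertex sets disjoint;
      \<open>vertex_Folkman_attained\<close> leads back to \<open>nat\<close>.\<close>
    let ?V = "(Inl :: nat \<Rightarrow> nat + nat) ` V" and ?W = "(Inr :: nat \<Rightarrow> nat + nat) ` W"
    have V: "Folkman_graph ?V ((`) Inl ` E) (replicate 2 2 @ [2]) (2 + 1)"
      by (rule Folkman_graph_image[OF G]) simp
    have W: "Folkman_graph ?W ((`) Inr ` F) (replicate 2 2 @ [p - 2]) (p - 2 + 1)"
      by (rule Folkman_graph_image[OF H]) simp
    have "\<exists>D. Folkman_graph (?V \<union> ?W) D (replicate 2 2 @ [2 + (p - 2)]) (2 + (p - 2) + 1)"
      by (rule exI, rule Folkman_graph_join[OF V W]) auto
    then obtain D where "Folkman_graph (?V \<union> ?W) D (replicate 2 2 @ [p]) (p + 1)"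
      using less.prems by (auto simp only: le_add_diff_inverse)
    then obtain U :: "nat set" and D' where "Folkman_graph U D' (replicate 2 2 @ [p]) (p + 1)"
      by (rule vertex_Folkman_attained)
    then show ?thesis by blast
  qed
qed

lemma Folkman_graph_Suc:
  assumes "Folkman_graph (V :: nat set) E (replicate r 2 @ [p]) q" "p > 0"
  shows "\<exists>(W :: nat set) F. Folkman_graph W F (replicate (Suc r) 2 @ [p]) (Suc q) \<and>
    card W = Suc (card V)"
proof -
  have "finite V" using assms(1) by (simp add: Folkman_graph_def simple_graph_def)
  moreover from this obtain v where v: "v \<notin> V"
    using ex_new_if_finite[OF infinite_UNIV_nat] by blast
  ultimately have "card (insert v V) = Suc (card V)" by simp
  then show ?thesis
    using Folkman_graph_add_universal_vertex[OF assms(1) v assms(2)] by blast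
qed

abbreviation (input) Folkman_twos :: "nat \<Rightarrow> nat \<Rightarrow> nat" where
  "Folkman_twos p r \<equiv> vertex_Folkman (replicate r 2 @ [p]) (r + p - 1)"

lemma Folkman_graph_twos_exists:
  assumes "p \<ge> 2" "r \<ge> 2"
  shows "\<exists>(V :: nat set) E. Folkman_graph V E (replicate r 2 @ [p]) (r + p - 1)"
  using assms(2)
proof (induction r rule: dec_induct)
  case base
  then show ?case using Folkman_graph_exists[OF assms(1)] by (simp add: add.commute)
next
  case (step r)
  then obtain V :: "nat set" and E where "Folkman_graph V E (replicate r 2 @ [p]) (r + p - 1)"
    by blast
  then have "\<exists>(W :: nat set) F. Folkman_graph W F (replicate (Suc r) 2 @ [p]) (Suc (r + p - 1))"
    using Folkman_graph_Suc[of V E r p] assms(1) by fastforce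
  moreover have "Suc (r + p - 1) = Suc r + p - 1" using assms(1) by simp
  ultimately show ?case by simp
qed

lemma Folkman_twos_attained:
  assumes "p \<ge> 2" "r \<ge> 2"
  obtains V :: "nat set" and E where "Folkman_graph V E (replicate r 2 @ [p]) (r + p - 1)"
    "card V = Folkman_twos p r"
proof -
  obtain V :: "nat set" and E where "Folkman_graph V E (replicate r 2 @ [p]) (r + p - 1)"
    using Folkman_graph_twos_exists[OF assms] by blast
  then show thesis by (rule vertex_Folkman_attained) (rule that)
qed

text \<open>In other words, the difference of \<open>Folkman_twos p r\<close> and \<open>r\<close>
  never increases with \<open>r\<close>.\<close>

lemma Folkman_twos_Suc_le:
  assumes "p \<ge> 2" "r \<ge> 2"
  shows "Folkman_twos p (Suc r) \<le> Suc (Folkman_twos p r)"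
proof -
  obtain V :: "nat set" and E where V: "Folkman_graph V E (replicate r 2 @ [p]) (r + p - 1)"
    "card V = Folkman_twos p r"
    using Folkman_twos_attained[OF assms] .
  obtain W :: "nat set" and F where "Folkman_graph W F (replicate (Suc r) 2 @ [p]) (Suc (r + p - 1))"
    "card W = Suc (card V)"
    using Folkman_graph_Suc[OF V(1)] assms(1) by auto
  moreover have "Suc (r + p - 1) = Suc r + p - 1" using assms by simp
  ultimately show ?thesis using vertex_Folkman_le V(2) by metis
qed

text \<open>Makes the differences nonnegative, so that natural subtraction is exact and a least
  difference exists.\<close>

lemma Folkman_twos_ge:
  assumes "p \<ge> 2" "r \<ge> 2"
  shows "r \<le> Folkman_twos p r"
proof -
  obtain V :: "nat set" and E where V: "Folkman_graph V E (replicate r 2 @ [p]) (r + p - 1)"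
    "card V = Folkman_twos p r"
    using Folkman_twos_attained[OF assms] .
  have "r + p \<le> card V"
    using V(1) assms by (intro arrows_twos_card[of V E]) (auto simp: Folkman_graph_def simple_graph_def)
  then show ?thesis using V(2) by simp
qed

section \<open>The first minimiser\<close>

text \<open>A minimiser exists by well-foundedness of \<open>nat\<close>, applied to the difference
  in \<open>nat\<close>; it carries over to \<open>int\<close> because no difference is
  truncated.\<close>

lemma Folkman_r0_is_arg_min:
  assumes "p \<ge> 2"
  shows "is_arg_min (\<lambda>r. int (Folkman_twos p r) - int r) (\<lambda>r. 2 \<le> r) (Folkman_r0 p)"
proof -
  obtain r where r: "2 \<le> r" "\<And>s. 2 \<le> s \<Longrightarrow> Folkman_twos p r - r \<le> Folkman_twos p s - s"
    using ex_has_least_nat[of "\<lambda>r. 2 \<le> r" 2 "\<lambda>r. Folkman_twos p r - r"] by auto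
  have "int (Folkman_twos p r) - int r \<le> int (Folkman_twos p s) - int s" if "2 \<le> s" for s
    using r(2)[OF that] Folkman_twos_ge[OF assms that] Folkman_twos_ge[OF assms r(1)] by linarith
  then have "is_arg_min (\<lambda>r. int (Folkman_twos p r) - int r) (\<lambda>r. 2 \<le> r) r"
    using r(1) by (auto simp: is_arg_min_def not_less)
  then show ?thesis unfolding Folkman_r0_def by (rule LeastI)
qed

lemma Folkman_r0_ge: "p \<ge> 2 \<Longrightarrow> 2 \<le> Folkman_r0 p"
  using Folkman_r0_is_arg_min[of p] by (auto simp: is_arg_min_def)

lemma Folkman_r0_le:
  assumes "p \<ge> 2" "r \<ge> 2"
  shows "Folkman_twos p (Folkman_r0 p) + r \<le> Folkman_twos p r + Folkman_r0 p"
proof -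
  have "\<not> int (Folkman_twos p r) - int r < int (Folkman_twos p (Folkman_r0 p)) - int (Folkman_r0 p)"
    using Folkman_r0_is_arg_min[OF assms(1)] assms(2) unfolding is_arg_min_def by blast
  then show ?thesis by linarith
qed

text \<open>Strictness comes from \<open>Folkman_r0\<close> being the least minimiser: equality
  would make the smaller \<open>r\<close> a minimiser too.\<close>

lemma Folkman_r0_less:
  assumes "p \<ge> 2" "r \<ge> 2" "r < Folkman_r0 p"
  shows "Folkman_twos p (Folkman_r0 p) + r < Folkman_twos p r + Folkman_r0 p"
proof (rule ccontr)
  assume "\<not> ?thesis"
  then have le: "int (Folkman_twos p r) - int r \<le> int (Folkman_twos p (Folkman_r0 p)) - int (Folkman_r0 p)"
    by linarith
  have "is_arg_min (\<lambda>r. int (Folkman_twos p r) - int r) (\<lambda>r. 2 \<le> r) r"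
    unfolding is_arg_min_def
  proof (intro conjI notI)
    assume "\<exists>s. 2 \<le> s \<and> int (Folkman_twos p s) - int s < int (Folkman_twos p r) - int r"
    then obtain s where s: "2 \<le> s" "int (Folkman_twos p s) - int s < int (Folkman_twos p r) - int r"
      by blast
    then show False using Folkman_r0_le[OF assms(1) s(1)] le by linarith
  qed (rule assms)
  then have "Folkman_r0 p \<le> r" unfolding Folkman_r0_def by (rule Least_le)
  then show False using assms(3) by simp
qed

text \<open>Universal vertices, added one at a time, give the upper bound; minimality of the
  difference at \<open>Folkman_r0 p\<close> gives the lower bound.\<close>

lemma Folkman_twos_eq:
  assumes "p \<ge> 2" "r \<ge> Folkman_r0 p"
  shows "Folkman_twos p r = Folkman_twos p (Folkman_r0 p) + (r - Folkman_r0 p)"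
proof (rule antisym)
  show "Folkman_twos p r \<le> Folkman_twos p (Folkman_r0 p) + (r - Folkman_r0 p)"
    using assms(2)
  proof (induction r rule: dec_induct)
    case (step r)
    then have "r \<ge> 2" using Folkman_r0_ge[OF assms(1)] by linarith
    then show ?case using step Folkman_twos_Suc_le[OF assms(1), of r] by linarith
  qed simp
  show "Folkman_twos p (Folkman_r0 p) + (r - Folkman_r0 p) \<le> Folkman_twos p r"
    using Folkman_r0_le[OF assms(1), of r] Folkman_r0_ge[OF assms(1)] assms(2) by linarith
qed

text \<open>A bad colouring provides a nonempty independent set \<open>A\<close> whose removal
  leaves a graph admissible for \<open>r0 - 1\<close> twos. Then
  \<open>Folkman_twos p (r0 - 1)\<close> is below \<open>Folkman_twos p r0\<close>, against
  \<open>Folkman_r0_less\<close>; that lemma applies since \<open>r0 > 2\<close>.\<close>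

lemma minimal_graph_arrows:
  fixes V :: "'a set"
  assumes "p \<ge> 2" and r0: "r0 = Folkman_r0 p" "r0 > 2"
    and G: "Folkman_graph V E (replicate r0 2 @ [p]) (r0 + p - 1)"
    and card: "card V = Folkman_twos p r0"
  shows "vertex_arrows V E [2, r0 + p - 2]"
proof (rule ccontr)
  assume "\<not> ?thesis"
  then have "\<not> vertex_arrows V E (replicate 1 2 @ [r0 + p - 2])" by simp
  then obtain c :: "'a \<Rightarrow> nat" where c: "c \<in> V \<rightarrow> {..1}"
      "\<not> (\<exists>u\<in>V. \<exists>v\<in>V. u \<noteq> v \<and> {u, v} \<in> E \<and> c u = c v \<and> c u < 1)"
      "\<not> (\<exists>K \<in> nsets V (r0 + p - 2). clique K E \<and> (\<forall>v\<in>K. c v = 1))"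
    unfolding vertex_arrows_twos_iff by blast
  have fin: "finite V"
    using G by (simp add: Folkman_graph_def simple_graph_def)
  have "V \<noteq> {}"
    using card Folkman_twos_ge[of p r0] assms by auto
  then obtain v where v: "v \<in> V" by blast
  \<comment> \<open>\<open>A\<close> must be nonempty for the vertex count to drop, so a single
    vertex is taken if colour 0 does not occur.\<close>
  define A where "A = (if \<exists>u\<in>V. c u = 0 then {u\<in>V. c u = 0} else {v})"
  have A: "A \<subseteq> V" "A \<noteq> {}" using v by (auto simp: A_def)
  have indep: False if "u \<in> A" "w \<in> A" "u \<noteq> w" "{u, w} \<in> E" for u w
  proof -
    have "u \<in> V" "w \<in> V" "c u = 0" "c w = 0"
      using that by (auto simp: A_def split: if_splits)
    then have "\<exists>u\<in>V. \<exists>v\<in>V. u \<noteq> v \<and> {u, v} \<in> E \<and> c u = c v \<and> c u < 1"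
      using that by (intro bexI[of _ u] bexI[of _ w]) simp_all
    then show False using c(2) by contradiction
  qed
  define B where "B = V - A"
  have cB: "c u = 1" if "u \<in> B" for u
  proof -
    have "c u \<noteq> 0" using that by (auto simp: B_def A_def split: if_splits)
    moreover have "c u \<le> 1" using c(1) that by (auto simp: B_def)
    ultimately show ?thesis by simp
  qed
  have "Folkman_graph B (E \<inter> nsets B 2) (replicate (r0 - 1) 2 @ [p]) (r0 - 1 + p - 1)"
  proof -
    have finB: "finite B" using fin by (simp add: B_def)
    have "vertex_arrows B (E \<inter> nsets B 2) (replicate (r0 - 1) 2 @ [p])"
      unfolding vertex_arrows_twos_iff
    proof (intro ballI disj_imp[THEN iffD2] impI)
      fix d assume d: "d \<in> B \<rightarrow> {..r0 - 1}"
        and no: "\<not> (\<exists>u\<in>B. \<exists>w\<in>B. u \<noteq> w \<and> {u, w} \<in> E \<inter> nsets B 2 \<and> d u = d w \<and> d u < r0 - 1)"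
      \<comment> \<open>\<open>A\<close> becomes an additional independent class of colour 0, and
        all colours of \<open>d\<close> move up by one.\<close>
      define d' where "d' u = (if u \<in> A then 0 else Suc (d u))" for u
      have "d' \<in> V \<rightarrow> {..r0}"
        using d r0(2) by (force simp: d'_def B_def Pi_iff)
      moreover have False if uw: "u \<in> V" "w \<in> V" "u \<noteq> w" "{u, w} \<in> E" "d' u = d' w" "d' u < r0" for u w
      proof (cases "u \<in> A")
        case True
        then have "w \<in> A" using uw(5) by (auto simp: d'_def split: if_splits)
        then show False using True indep uw by blast
      next
        case False
        then have "u \<in> B" "w \<in> B" "d u = d w" "d u < r0 - 1"
          using uw by (auto simp: d'_def B_def split: if_splits)
        moreover from this have "{u, w} \<in> E \<inter> nsets B 2" using uw by (auto simp: nsets_def)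
        ultimately show False using no uw(3) by blast
      qed
      ultimately obtain K where K: "K \<in> nsets V p" "clique K E" "\<forall>u\<in>K. d' u = r0"
        using G unfolding Folkman_graph_def vertex_arrows_twos_iff by metis
      have KB: "u \<in> B" "d u = r0 - 1" if "u \<in> K" for u
        using K(1,3) that r0(2) by (force simp: d'_def B_def nsets_def split: if_splits)+
      moreover have "clique K (E \<inter> nsets B 2)"
        using K(2) KB(1) by (auto simp: clique_def nsets_def)
      ultimately show "\<exists>K\<in>nsets B p. clique K (E \<inter> nsets B 2) \<and> (\<forall>v\<in>K. d v = r0 - 1)"
        using K(1) by (intro bexI[of _ K]) (auto simp: nsets_def)
    qed
    moreover have "card K < r0 - 1 + p - 1" if K: "K \<subseteq> B" "clique K (E \<inter> nsets B 2)" for K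
    proof (rule ccontr)
      assume "\<not> ?thesis"
      \<comment> \<open>The bound for \<open>r0 - 1\<close> twos, \<open>r0 - 1 + p - 1\<close>, is
        exactly the clique size that \<open>c\<close> excludes from colour 1.\<close>
      then have "r0 + p - 2 \<le> card K" by linarith
      then obtain L where L: "L \<subseteq> K" "card L = r0 + p - 2" "finite L"
        using obtain_subset_with_card_n by blast
      then have "L \<in> nsets V (r0 + p - 2)" "\<forall>u\<in>L. c u = 1"
        using K(1) cB by (auto simp: nsets_def B_def)
      moreover have "clique L E"
        by (rule clique_change_edges[OF K(2) L(1)]) simp
      ultimately show False using c(3) by blast
    qed
    ultimately show ?thesis
      using finB by (auto simp: Folkman_graph_def simple_graph_def clique_number_less_iff)
  qed
  then have "Folkman_twos p (r0 - 1) \<le> card B" by (rule vertex_Folkman_le)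
  moreover have "card B < card V"
    using A fin unfolding B_def by (intro psubset_card_mono) auto
  moreover have "Folkman_twos p r0 + (r0 - 1) < Folkman_twos p (r0 - 1) + r0"
    using Folkman_r0_less[OF assms(1), of "r0 - 1"] r0 by simp
  ultimately show False using card r0(2) by linarith
qed

section \<open>Bounds from robust cliques\<close>

text \<open>Give the first colour to \<open>v\<close> alone.\<close>

lemma arrows_2_imp_robust_clique:
  assumes "vertex_arrows V E [2, a]" "v \<in> V"
  shows "\<exists>K \<subseteq> V - {v}. clique K E \<and> card K = a"
proof -
  have "(\<lambda>u. if u = v then 0 else 1) \<in> V \<rightarrow> {..1::nat}" by auto
  moreover have "vertex_arrows V E (replicate 1 2 @ [a])" using assms(1) by simp
  ultimately obtain K where
    "K \<in> nsets V a" "clique K E" "\<forall>u\<in>K. (if u = v then 0 else 1) = (1::nat)"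
    unfolding vertex_arrows_twos_iff by (fastforce split: if_splits)
  then show ?thesis by (intro exI[of _ K]) (auto simp: nsets_def split: if_splits)
qed

text \<open>The first colour goes to \<open>v\<close> alone and the second to the non-adjacent pair,
  so the clique has to avoid all three.\<close>

lemma arrows_2_2_imp_robust_clique:
  assumes "vertex_arrows V E [2, 2, p]" "x \<in> V" "y \<in> V" "{x, y} \<notin> E" "v \<in> V - {x, y}"
  shows "\<exists>K \<subseteq> V - {x, y} - {v}. clique K E \<and> card K = p"
proof -
  define c where "c u = (if u = v then 0 else if u \<in> {x, y} then 1 else 2 :: nat)" for u
  have "c \<in> V \<rightarrow> {..2}" by (auto simp: c_def)
  moreover have "\<not> (\<exists>u\<in>V. \<exists>w\<in>V. u \<noteq> w \<and> {u, w} \<in> E \<and> c u = c w \<and> c u < 2)"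
    using assms(4,5) by (auto simp: c_def insert_commute split: if_splits)
  moreover have "vertex_arrows V E (replicate 2 2 @ [p])"
    using assms(1) by (simp add: numeral_2_eq_2)
  ultimately obtain K where "K \<in> nsets V p" "clique K E" "\<forall>u\<in>K. c u = 2"
    unfolding vertex_arrows_twos_iff by blast
  then show ?thesis by (intro exI[of _ K]) (auto simp: nsets_def c_def split: if_splits)
qed

text \<open>Delete a non-adjacent pair, colour the rest with \<open>card V - 2 - p\<close> colours,
  and give the pair one further colour. Arrowing requires at least \<open>2 + p\<close> colours,
  hence \<open>2 * p + 3 \<le> card V\<close>.\<close>

lemma Folkman_2_2_lower_bound:
  assumes "p \<ge> 2"
  shows "2 * p + 3 \<le> Folkman_twos p 2"
proof -
  obtain V :: "nat set" and E where G: "Folkman_graph V E (replicate 2 2 @ [p]) (2 + p - 1)"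
    and card: "card V = Folkman_twos p 2"
    using Folkman_twos_attained[OF assms order.refl] .
  have fin: "finite V" using G by (simp add: Folkman_graph_def simple_graph_def)
  have arr: "vertex_arrows V E (replicate 2 2 @ [p])" using G by (simp add: Folkman_graph_def)
  have max: "card K \<le> p" if "K \<subseteq> V" "clique K E" for K
    using Folkman_graph_card_clique_less[OF G that] by simp
  have n: "2 + p \<le> card V" using arrows_twos_card[OF fin arr] assms by simp
  \<comment> \<open>\<open>V\<close> has at least \<open>p + 2\<close> vertices but no clique has
    more than \<open>p\<close>, so a non-adjacent pair exists.\<close>
  then have "\<not> clique V E" using max[of V] by auto
  then obtain x y where xy: "x \<in> V" "y \<in> V" "x \<noteq> y" "{x, y} \<notin> E"
    by (auto simp: clique_def)
  define W where "W = V - {x, y}"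
  have cW: "card W = card V - 2" using xy by (simp add: W_def card_Diff_subset)
  have "\<exists>c. proper_coloring W E (card W - p) c"
  proof (rule robust_clique_number_imp_proper_coloring)
    show "W \<noteq> {}" using cW n assms by auto
    show "\<exists>K\<subseteq>W - {v}. clique K E \<and> card K = p" if "v \<in> W" for v
      using arrows_2_2_imp_robust_clique[of V E p x y v] arr xy that
      by (simp add: W_def numeral_2_eq_2)
  qed (use fin max in \<open>auto simp: W_def\<close>)
  then obtain c where c: "proper_coloring W E (card W - p) c" by blast
  define d where "d u = (if u \<in> W then c u else card W - p)" for u
  have "proper_coloring V E (Suc (card W - p)) d"
    unfolding proper_coloring_def
  proof (intro conjI ballI impI)
    show "d \<in> V \<rightarrow> {..<Suc (card W - p)}"
      using c by (force simp: d_def proper_coloring_def)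
    fix u w assume uw: "u \<in> V" "w \<in> V" "u \<noteq> w \<and> {u, w} \<in> E"
    have lt: "c z < card W - p" if "z \<in> W" for z using c that by (auto simp: proper_coloring_def)
    show "d u \<noteq> d w"
    proof (cases "u \<in> W \<or> w \<in> W")
      case True
      then show ?thesis
        using uw c lt[of u] lt[of w] by (auto simp: d_def proper_coloring_def)
    next
      case False
      then have "{u, w} = {x, y}" using uw by (auto simp: W_def)
      then show ?thesis using uw xy(4) by simp
    qed
  qed
  then have "2 + p \<le> Suc (card W - p)"
    by (rule arrows_twos_proper_coloring[OF arr]) (use assms in simp)
  then show ?thesis using cW card n by linarith
qed

text \<open>For \<open>r0 > 2\<close> the colouring bound gives
  \<open>2 * r0 + 2 * p - 2 \<le> Folkman_twos p r0\<close>, and \<open>Folkman_r0_less\<close> at 2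
  gives \<open>Folkman_twos p r0 + 2 < Folkman_twos p 2 + r0\<close>; adding the two yields the
  claim. For \<open>r0 = 2\<close> it is \<open>Folkman_2_2_lower_bound\<close>.\<close>

lemma Folkman_r0_bound:
  assumes "p \<ge> 2"
  shows "Folkman_r0 p + 2 * p < Folkman_twos p 2"
proof (cases "Folkman_r0 p = 2")
  case True
  then show ?thesis using Folkman_2_2_lower_bound[OF assms] by simp
next
  case False
  define r0 where "r0 = Folkman_r0 p"
  have r0: "r0 > 2" using False Folkman_r0_ge[OF assms] by (simp add: r0_def)
  obtain V :: "nat set" and E where G: "Folkman_graph V E (replicate r0 2 @ [p]) (r0 + p - 1)"
    and card: "card V = Folkman_twos p r0"
    using Folkman_twos_attained[OF assms, of r0] r0 by auto
  have fin: "finite V" using G by (simp add: Folkman_graph_def simple_graph_def)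
  have arr: "vertex_arrows V E (replicate r0 2 @ [p])" using G by (simp add: Folkman_graph_def)
  have "r0 + p \<le> card V" using arrows_twos_card[OF fin arr] assms by simp
  have "\<exists>c. proper_coloring V E (card V - (r0 + p - 2)) c"
  proof (rule robust_clique_number_imp_proper_coloring)
    show "V \<noteq> {}" using \<open>r0 + p \<le> card V\<close> assms by auto
    show "card K \<le> r0 + p - 2" if "K \<subseteq> V" "clique K E" for K
      using Folkman_graph_card_clique_less[OF G that] by simp
    show "\<exists>K\<subseteq>V - {v}. clique K E \<and> card K = r0 + p - 2" if "v \<in> V" for v
      using minimal_graph_arrows[OF assms r0_def r0 G card] that
      by (rule arrows_2_imp_robust_clique)
  qed (rule fin)
  then have "r0 + p \<le> card V - (r0 + p - 2)"
    using arrows_twos_proper_coloring[OF arr] assms by auto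
  moreover have "Folkman_twos p r0 + 2 < Folkman_twos p 2 + r0"
    using Folkman_r0_less[OF assms order.refl] r0 by (simp add: r0_def)
  ultimately show ?thesis using card r0 by (simp add: r0_def[symmetric])
qed

lemma Folkman_twos_2: "Folkman_twos p 2 = vertex_Folkman [2, 2, p] (p + 1)"
  by (simp add: numeral_2_eq_2)

lemma Folkman_r0_5: "Folkman_r0 5 \<le> 5"
proof -
  have "vertex_Folkman [2, 2, 5] (5 + 1) \<le> 16"
    using graph_2_2_5 vertex_Folkman_le by metis
  then have "Folkman_twos 5 2 \<le> 16" by (simp only: Folkman_twos_2)
  \<comment> \<open>The bound reads \<open>Folkman_r0 5 + 10 < 16\<close>.\<close>
  then show ?thesis using Folkman_r0_bound[of 5] by linarith
qed

theorem theorem9: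
  fixes p r0 :: nat
  assumes "p \<ge> 2"
    and "r0 = Folkman_r0 p"
  shows "(\<forall>r \<ge> r0. vertex_Folkman (replicate r 2 @ [p]) (r + p - 1)
            = vertex_Folkman (replicate r0 2 @ [p]) (r0 + p - 1) + (r - r0))
       \<and> (r0 = 2 \<longrightarrow> (\<forall>r \<ge> 2. vertex_Folkman (replicate r 2 @ [p]) (r + p - 1)
            = vertex_Folkman [2, 2, p] (p + 1) + (r - 2)))
       \<and> (r0 > 2 \<longrightarrow> (\<forall>(V :: 'a set) E. simple_graph V E \<and>
            vertex_arrows V E (replicate r0 2 @ [p]) \<and> clique_number V E < r0 + p - 1 \<and>
            card V = vertex_Folkman (replicate r0 2 @ [p]) (r0 + p - 1)
            \<longrightarrow> vertex_arrows V E [2, r0 + p - 2]))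
       \<and> int r0 < int (vertex_Folkman [2, 2, p] (p + 1)) - 2 * int p
       \<and> Folkman_r0 5 \<le> 5"
proof -
  have a: "\<forall>r \<ge> r0. Folkman_twos p r = Folkman_twos p r0 + (r - r0)"
    using Folkman_twos_eq assms by blast
  moreover have "r0 = 2 \<longrightarrow> (\<forall>r \<ge> 2. Folkman_twos p r = vertex_Folkman [2, 2, p] (p + 1) + (r - 2))"
    using a unfolding Folkman_twos_2[symmetric] by blast
  moreover have "r0 > 2 \<longrightarrow> (\<forall>(V :: 'a set) E. simple_graph V E \<and>
      vertex_arrows V E (replicate r0 2 @ [p]) \<and> clique_number V E < r0 + p - 1 \<and>
      card V = Folkman_twos p r0 \<longrightarrow> vertex_arrows V E [2, r0 + p - 2])"
    using minimal_graph_arrows[OF assms] unfolding Folkman_graph_def by blast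
  moreover have "int r0 < int (vertex_Folkman [2, 2, p] (p + 1)) - 2 * int p"
    using Folkman_r0_bound[OF assms(1)] unfolding Folkman_twos_2 assms(2) by linarith
  ultimately show ?thesis using Folkman_r0_5 by blast
qed

end
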